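(* Consider the $K$-user OFDMA system with birth-death queue transition kernel described in the context. Under the average power constraint $\sum_{k=1}^K\sum_{n=1}^{N_F}\mathbb E[p_{k,n}]\le P_0$, $p_{k,n}\ge0$ (with Lagrange multiplier $\gamma>0$), and under a given CSI-only subcarrier allocation policy $\widetilde\Omega_s(\mathbf H)=\{\tilde s_{k,n}(\mathbf H)\in\{0,1\}:\sum_{k=1}^K\tilde s_{k,n}=1\ \forall n\}$, the solution $(\theta,\{\widetilde V(\mathbf Q)\})$ of the reduced-state Bellman equation $$\theta+\widetilde V(\mathbf Q^i)=\min_{\mathbf u(\mathbf Q^i)}\Bigl[\widetilde g(\mathbf Q^i,\mathbf u(\mathbf Q^i))+\sum_{\mathbf Q^j}\widetilde f(\mathbf Q^j\mid\mathbf Q^i,\mathbf u(\mathbf Q^i))\widetilde V(\mathbf Q^j)\Bigr],\qquad 1\le i\le I,$$ can be expressed in the form $\widetilde V(\mathbf Q)=\sum_k\widetilde V_k(Q_k)$ and $\theta=\sum_k\theta_k$, where, for each $k$, $\{\widetilde V_k(Q_k),\theta_k\}$ is the solution of the $k$-th user's reduced Bellman equation $$\theta_k=\min_{\mathbf u_k(Q_k)}\Bigl\{\widetilde g_k(Q_k,\mathbf u_k(Q_k))+\lambda_k\tau\,\Delta\widetilde V_k(Q_k+1)-\overline\mu_k(Q_k)\tau\,\Delta\widetilde V_k(Q_k)\Bigr\},\qquad 0\le Q_k\le N_Q.$$ Here $\mathbf u_k(Q_k)=\{(\tilde p(\mathbf H,Q_k),\tilde s(\mathbf H)):\forall\,\mathbf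 H\}$ is the set of conditional control actions, $$\overline\mu_k(Q_k)=\frac{1}{\overline N_k}\mathbb E\Bigl[\sum_{n=1}^{N_F}\tilde s_{k,n}(\mathbf H)\log\bigl(1+\tilde p_{k,n}(\mathbf H,Q_k)|H_{k,n}|^2\bigr)\Big|Q_k\Bigr]$$ is the conditional average service rate, and $\Delta\widetilde V_k(Q_k)=\widetilde V_k(Q_k)-\widetilde V_k([Q_k-1]^+)$ is the potential increment of the $k$-th queue.
   Context: **System.** There are $K$ users, $N_F$ subcarriers and slots of duration $\tau$. The CSI $\mathbf H=\{H_{k,n}\}$ has entries $H_{k,n}\sim\mathcal{CN}(0,1)$ and is i.i.d. over slots. The joint queue state $\mathbf Q=(Q_1,\dots,Q_K)$ lies in $\{0,\dots,N_Q\}^K=\{\mathbf Q^1,\dots,\mathbf Q^I\}$, $I=(N_Q+1)^K$, with $\mathbf Q^i=(Q_1^i,\dots,Q_K^i)$. Arrivals to queue $k$ are Poisson with rate $\lambda_k$, packet sizes are exponential with mean $\overline N_k$, and $\tau$ is small enough ($\lambda_k\tau\ll1$, $\mu_k\tau\ll1$) that the queue transition kernel is taken to be the birth-death kernel below. The system state is $\boldsymbol\chi=(\mathbf H,\mathbf Q)$; an action consists of powers $\mathbf p=\{p_{k,n}\ge0\}$ and subcarrier indicators $\mathbf s=\{s_{k,n}\in\{0,1\}\}$ with $\sum_ks_{k,n}=1$ for each $n$. $\mathbf u(\mathbf Q)$ denotes the collection of actions at $(\mathbf H,\mathbf Q)$ over all $\mathbf H$. The notation $\log$ is the natural logarithm,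 and $x^+=[x]^+=\max\{x,0\}$. **Reward.** With weights $\beta_k>0$ and Lagrange multiplier $\gamma>0$, $$\widetilde g(\mathbf Q,\mathbf u(\mathbf Q))=\mathbb E\Bigl[\sum_k\beta_k\frac{Q_k}{\lambda_k}+\gamma\sum_{k,n}p_{k,n}\Big|\mathbf Q\Bigr],\qquad \widetilde g_k(Q_k,\mathbf u_k(Q_k))=\beta_k\frac{Q_k}{\lambda_k}+\gamma\,\mathbb E\Bigl[\sum_n\tilde p_{k,n}(\mathbf H,Q_k)\Big|Q_k\Bigr].$$ **Kernel.** With $\overline\mu_k(\mathbf Q)=\mathbb E[\sum_ns_{k,n}\log(1+p_{k,n}|H_{k,n}|^2)\mid\mathbf Q]/\overline N_k$, the kernel $\widetilde f(\cdot\mid\mathbf Q^i,\mathbf u(\mathbf Q^i))$ assigns, for every $k$, mass $\lambda_k\tau$ to $(Q_1^i,\dots,\min\{Q_k^i+1,N_Q\},\dots,Q_K^i)$ and mass $\overline\mu_k(\mathbf Q^i)\tau$ to $(Q_1^i,\dots,(Q_k^i-1)^+,\dots,Q_K^i)$, and the remaining mass $1-\sum_k(\lambda_k\tau+\overline\mu_k(\mathbf Q^i)\tau)$ to $\mathbf Q^i$ (masses assigned to coinciding states are added). Accordingly $\widetilde V_k(N_Q+1)$ is read as $\widetilde V_k(N_Q)$. **Restricted minimization.** Under a CSI-only subcarrier allocation policy, the subcarrier actions are $s_{k,n}=\tilde s_{k,n}(\mathbf H)$, depending on $\mathbf H$ only; the minimizations in the Bellman equations are then over the power actions. Solutions of the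 Bellman equations are understood up to an additive constant in the potential. *)

theory Defs
  imports "HOL-Probability.Probability"
begin

text \<open>
  Users are the elements of the finite type \<open>'k\<close>, subcarriers those of the finite type \<open>'n\<close>.
  A CSI realisation is a matrix \<open>H\<close> with entries \<open>H $ k $ n\<close>. The CSI is i.i.d. over slots, hence
  independent of the current queue state, so a conditional expectation given the queue state is
  the integral over the one-slot law \<open>M\<close> of \<open>H\<close>, with the queue state held fixed.
\<close>

type_synonym ('n, 'k) csi = "complex ^ 'n ^ 'k"

text \<open>The density of the circularly symmetric complex normal distribution \<open>CN(0,1)\<close> with respect
  to Lebesgue measure on the plane (mean 0 and \<open>E |Z|^2 = 1\<close>).\<close>

definition std_complex_normal_density :: "complex \<Rightarrow> real" where
  "std_complex_normal_density z = exp (- (cmod z)\<^sup>2) / pi"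

definition csi_law :: "('n::finite, 'k::finite) csi measure \<Rightarrow> bool" where
  "csi_law M \<longleftrightarrow> prob_space M \<and> sets M = sets borel \<and>
     (\<forall>k n. distributed M lborel (\<lambda>H. H $ k $ n) (\<lambda>z. ennreal (std_complex_normal_density z)))"

definition csi_only_subcarrier_policy ::
  "('n::finite, 'k::finite) csi measure \<Rightarrow> (('n, 'k) csi \<Rightarrow> 'k \<Rightarrow> 'n \<Rightarrow> real) \<Rightarrow> bool" where
  "csi_only_subcarrier_policy M s \<longleftrightarrow>
     (\<forall>k n. (\<lambda>H. s H k n) \<in> borel_measurable M) \<and>
     (\<forall>H k n. s H k n \<in> {0, 1}) \<and>
     (\<forall>H n. (\<Sum>k\<in>UNIV. s H k n) = 1)"

text \<open>
  Power actions at a fixed queue state, as functions of the CSI. Non-integrable powers have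
  infinite cost; they have to be excluded explicitly because the Bochner integral of a
  non-integrable function is 0.
\<close>

definition user_power_actions ::
  "('n::finite, 'k::finite) csi measure \<Rightarrow> (('n, 'k) csi \<Rightarrow> 'n \<Rightarrow> real) set" where
  "user_power_actions M = {p. \<forall>n. (\<forall>H. 0 \<le> p H n) \<and> integrable M (\<lambda>H. p H n)}"

definition power_actions ::
  "('n::finite, 'k::finite) csi measure \<Rightarrow> (('n, 'k) csi \<Rightarrow> 'k \<Rightarrow> 'n \<Rightarrow> real) set" where
  "power_actions M = {p. \<forall>k n. (\<forall>H. 0 \<le> p H k n) \<and> integrable M (\<lambda>H. p H k n)}"

text \<open>Parameter \<open>Nb k\<close> is the mean packet size of user \<open>k\<close>; \<open>p\<close> is the power action of user \<open>k\<close>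
  alone.\<close>

definition mean_service_rate ::
  "('n::finite, 'k::finite) csi measure \<Rightarrow> (('n, 'k) csi \<Rightarrow> 'k \<Rightarrow> 'n \<Rightarrow> real) \<Rightarrow>
   ('k \<Rightarrow> real) \<Rightarrow> 'k \<Rightarrow> (('n, 'k) csi \<Rightarrow> 'n \<Rightarrow> real) \<Rightarrow> real" where
  "mean_service_rate M s Nb k p =
     (LINT H|M. (\<Sum>n\<in>UNIV. s H k n * ln (1 + p H n * (cmod (H $ k $ n))\<^sup>2))) / Nb k"

definition reward ::
  "('n::finite, 'k::finite) csi measure \<Rightarrow> ('k \<Rightarrow> real) \<Rightarrow> ('k \<Rightarrow> real) \<Rightarrow> real \<Rightarrow>
   ('k \<Rightarrow> nat) \<Rightarrow> (('n, 'k) csi \<Rightarrow> 'k \<Rightarrow> 'n \<Rightarrow> real) \<Rightarrow> real" where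
  "reward M \<beta> arr \<gamma> Q p =
     (LINT H|M. (\<Sum>k\<in>UNIV. \<beta> k * real (Q k) / arr k) + \<gamma> * (\<Sum>k\<in>UNIV. \<Sum>n\<in>UNIV. p H k n))"

definition user_reward ::
  "('n::finite, 'k::finite) csi measure \<Rightarrow> ('k \<Rightarrow> real) \<Rightarrow> ('k \<Rightarrow> real) \<Rightarrow> real \<Rightarrow>
   'k \<Rightarrow> nat \<Rightarrow> (('n, 'k) csi \<Rightarrow> 'n \<Rightarrow> real) \<Rightarrow> real" where
  "user_reward M \<beta> arr \<gamma> k q p =
     \<beta> k * real q / arr k + \<gamma> * (LINT H|M. (\<Sum>n\<in>UNIV. p H n))"

definition queue_states :: "nat \<Rightarrow> ('k::finite \<Rightarrow> nat) set" where
  "queue_states NQ = {Q. \<forall>k. Q k \<le> NQ}"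

text \<open>
  Mass moved from \<open>Q\<close> to \<open>Q'\<close> for arrival rates \<open>arr\<close>, service rates \<open>\<mu>\<close> and slot duration \<open>\<tau>\<close>.
  Masses assigned to coinciding states add up (at a full or an empty queue the up- or down-state
  is \<open>Q\<close> itself). The subtraction \<open>Q k - 1\<close> is truncated at 0.
\<close>

definition birth_death_kernel ::
  "nat \<Rightarrow> ('k::finite \<Rightarrow> real) \<Rightarrow> real \<Rightarrow> ('k \<Rightarrow> real) \<Rightarrow> ('k \<Rightarrow> nat) \<Rightarrow> ('k \<Rightarrow> nat) \<Rightarrow> real" where
  "birth_death_kernel NQ arr \<tau> \<mu> Q Q' =
     (\<Sum>k\<in>UNIV. arr k * \<tau> * of_bool (Q' = Q(k := min (Q k + 1) NQ))
             + \<mu> k * \<tau> * of_bool (Q' = Q(k := Q k - 1)))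
     + (1 - (\<Sum>k\<in>UNIV. arr k * \<tau> + \<mu> k * \<tau>)) * of_bool (Q' = Q)"

text \<open>The potential increment \<open>V q - V (q - 1)\<close> (with \<open>q - 1\<close> truncated at 0), where
  \<open>V (NQ + 1)\<close> is read as \<open>V NQ\<close>.\<close>

definition potential_increment :: "nat \<Rightarrow> (nat \<Rightarrow> real) \<Rightarrow> nat \<Rightarrow> real" where
  "potential_increment NQ V q = V (min q NQ) - V (q - 1)"

definition is_minimum :: "'a::order \<Rightarrow> 'a set \<Rightarrow> bool" where
  "is_minimum m S \<longleftrightarrow> m \<in> S \<and> (\<forall>y\<in>S. m \<le> y)"

definition bellman_solution ::
  "('n::finite, 'k::finite) csi measure \<Rightarrow> (('n, 'k) csi \<Rightarrow> 'k \<Rightarrow> 'n \<Rightarrow> real) \<Rightarrow>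
   ('k \<Rightarrow> real) \<Rightarrow> ('k \<Rightarrow> real) \<Rightarrow> ('k \<Rightarrow> real) \<Rightarrow> real \<Rightarrow> real \<Rightarrow> nat \<Rightarrow>
   real \<Rightarrow> (('k \<Rightarrow> nat) \<Rightarrow> real) \<Rightarrow> bool" where
  "bellman_solution M s Nb \<beta> arr \<gamma> \<tau> NQ \<theta> V \<longleftrightarrow>
     (\<forall>Q\<in>queue_states NQ.
        is_minimum (\<theta> + V Q)
          ((\<lambda>p. reward M \<beta> arr \<gamma> Q p
               + (\<Sum>Q'\<in>queue_states NQ.
                    birth_death_kernel NQ arr \<tau>
                      (\<lambda>k. mean_service_rate M s Nb k (\<lambda>H. p H k)) Q Q' * V Q'))
           ` power_actions M))"

definition user_bellman_solution ::
  "('n::finite, 'k::finite) csi measure \<Rightarrow> (('n, 'k) csi \<Rightarrow> 'k \<Rightarrow> 'n \<Rightarrow> real) \<Rightarrow>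
   ('k \<Rightarrow> real) \<Rightarrow> ('k \<Rightarrow> real) \<Rightarrow> ('k \<Rightarrow> real) \<Rightarrow> real \<Rightarrow> real \<Rightarrow> nat \<Rightarrow>
   'k \<Rightarrow> real \<Rightarrow> (nat \<Rightarrow> real) \<Rightarrow> bool" where
  "user_bellman_solution M s Nb \<beta> arr \<gamma> \<tau> NQ k \<theta> V \<longleftrightarrow>
     (\<forall>q\<in>{0..NQ}.
        is_minimum \<theta>
          ((\<lambda>p. user_reward M \<beta> arr \<gamma> k q p
               + arr k * \<tau> * potential_increment NQ V (q + 1)
               - mean_service_rate M s Nb k p * \<tau> * potential_increment NQ V q)
           ` user_power_actions M))"

text \<open>Existence and uniqueness of a solution \<open>(\<theta>, V)\<close>, with the potential \<open>V\<close> on the state space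
  \<open>D\<close> determined up to an additive constant. Values of \<open>V\<close> outside \<open>D\<close> are irrelevant.\<close>

definition has_solution_unique_up_to_constant ::
  "'q set \<Rightarrow> (real \<Rightarrow> ('q \<Rightarrow> real) \<Rightarrow> bool) \<Rightarrow> bool" where
  "has_solution_unique_up_to_constant D S \<longleftrightarrow>
     (\<exists>\<theta> V. \<forall>\<theta>' V'. S \<theta>' V' \<longleftrightarrow> \<theta>' = \<theta> \<and> (\<exists>c. \<forall>x\<in>D. V' x = V x + c))"

end

theory Submission
  imports Defs
begin

text \<open>
  Both Bellman equations are difference equations in the potential, because the minimised
  expression depends on the power actions only through the minimum \<open>F d\<close> over the actions of one
  user of (cost of power) - (service rate) * \<open>\<tau>\<close> * \<open>d\<close>, where \<open>d\<close> is the downward increment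
  of the potential. As an attained minimum of affine functions of \<open>d\<close> with nonpositive slopes, \<open>F\<close>
  is concave, hence continuous, and nonincreasing; it vanishes for \<open>d \<le> 0\<close>.

  Uniqueness is a maximum principle: where the difference of two potentials is maximal, upward
  increments compare one way and downward increments the other way, which orders the two values
  of \<open>\<theta>\<close>. Once these agree, maximal and minimal points of the difference propagate along arrivals
  to the full state, so the difference is constant. Existence for one user is the intermediate
  value theorem in \<open>\<theta>\<close>: the equations at \<open>0, \<dots>, NQ - 1\<close> determine the increments from \<open>\<theta>\<close>, and the
  one at \<open>NQ\<close> is then a scalar equation. Summing over the users solves the joint equation.
\<close>

section \<open>Attained minima\<close>

lemma is_minimum_unique: "is_minimum m S \<Longrightarrow> is_minimum m' S \<longleftrightarrow> m' = m"
  unfolding is_minimum_def by (metis order_antisym)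

lemma is_minimum_add_const:
  fixes c m :: real
  assumes "is_minimum m (f ` S)"
  shows "is_minimum (c + m) ((\<lambda>x. c + f x) ` S)"
  using assms unfolding is_minimum_def by auto

text \<open>The coordinates \<open>c k p\<close> of an action can be prescribed independently, so
  minimisers of the single summands combine into one action. In the application,
  \<open>c k p\<close> is the power action of user \<open>k\<close> within the joint action
  \<open>p\<close>.\<close>

lemma is_minimum_sum:
  fixes m :: "'k::finite \<Rightarrow> real"
  assumes "\<And>k. is_minimum (m k) (f k ` U)"
    and "\<And>p k. p \<in> P \<Longrightarrow> c k p \<in> U"
    and "\<And>u. (\<And>k. u k \<in> U) \<Longrightarrow> \<exists>p\<in>P. \<forall>k. c k p = u k"
  shows "is_minimum (\<Sum>k\<in>UNIV. m k) ((\<lambda>p. \<Sum>k\<in>UNIV. f k (c k p)) ` P)"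
proof -
  have "\<forall>k. \<exists>u\<in>U. m k = f k u"
    using assms(1) unfolding is_minimum_def by blast
  then obtain u where u: "\<And>k. u k \<in> U" "\<And>k. m k = f k (u k)"
    by metis
  obtain p where "p \<in> P" "\<forall>k. c k p = u k"
    using assms(3)[of u] u(1) by blast
  then have "(\<Sum>k\<in>UNIV. m k) \<in> (\<lambda>p. \<Sum>k\<in>UNIV. f k (c k p)) ` P"
    using u(2) by (intro image_eqI[of _ _ p]) auto
  moreover have "(\<Sum>k\<in>UNIV. m k) \<le> (\<Sum>k\<in>UNIV. f k (c k p))" if "p \<in> P" for p
    using assms(1) assms(2)[OF that] unfolding is_minimum_def by (intro sum_mono) blast
  ultimately show ?thesis
    unfolding is_minimum_def by blast
qed

lemma minimum_of_affine:
  fixes F :: "real \<Rightarrow> real"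
  assumes min: "\<And>d. is_minimum (F d) ((\<lambda>p. A p - B p * d) ` P)"
    and B: "\<And>p. p \<in> P \<Longrightarrow> 0 \<le> B p"
  shows minimum_of_affine_antimono: "antimono F"
    and minimum_of_affine_continuous: "continuous_on UNIV F"
proof -
  have le: "F d \<le> A p - B p * d" if "p \<in> P" for p d
    using min[of d] that unfolding is_minimum_def by blast
  have att: "\<exists>p\<in>P. F d = A p - B p * d" for d
    using min[of d] unfolding is_minimum_def by blast
  show "antimono F"
  proof (rule antimonoI)
    fix d d' :: real
    assume "d \<le> d'"
    obtain p where p: "p \<in> P" "F d = A p - B p * d"
      using att by blast
    have "B p * d \<le> B p * d'"
      using B[OF p(1)] \<open>d \<le> d'\<close> by (rule mult_left_mono[rotated])
    then show "F d' \<le> F d"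
      using le[OF p(1), of d'] p(2) by linarith
  qed
  have "convex_on UNIV (\<lambda>d. - F d)"
  proof (rule convex_onI)
    fix t x y :: real
    assume t: "0 < t" "t < 1"
    \<comment> \<open>The affine function attained at the intermediate point lies above
      \<open>F\<close> at both \<open>x\<close> and \<open>y\<close>, which gives concavity.\<close>
    obtain p where p: "p \<in> P" "F ((1 - t) *\<^sub>R x + t *\<^sub>R y) = A p - B p * ((1 - t) *\<^sub>R x + t *\<^sub>R y)"
      using att by blast
    have "(1 - t) * F x \<le> (1 - t) * (A p - B p * x)" "t * F y \<le> t * (A p - B p * y)"
      using t le[OF p(1)] by (auto intro!: mult_left_mono)
    then show "- F ((1 - t) *\<^sub>R x + t *\<^sub>R y) \<le> (1 - t) * - F x + t * - F y"
      unfolding p(2) by (simp add: algebra_simps)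
  qed simp
  then have "continuous_on UNIV (\<lambda>d. - (- F d))"
    by (intro continuous_on_minus convex_on_continuous) auto
  then show "continuous_on UNIV F"
    by simp
qed

lemma finite_attains_maximum:
  fixes f :: "'a \<Rightarrow> real"
  assumes "finite D" "D \<noteq> {}"
  shows "\<exists>x\<in>D. \<forall>y\<in>D. f y \<le> f x"
  using Max_in[of "f ` D"] Max_ge[of "f ` D"] assms by (metis empty_is_image finite_imageI imageE imageI)

section \<open>The difference equation\<close>

text \<open>Transitions are abstract maps so that one theory serves both equations: \<open>I\<close>
  is a singleton for a single queue and the set of all users for the joint state. \<open>F i\<close>
  stands for the minimised control cost.\<close>

definition difference_equation ::
  "'i set \<Rightarrow> 'q set \<Rightarrow> ('i \<Rightarrow> 'q \<Rightarrow> 'q) \<Rightarrow> ('i \<Rightarrow> 'q \<Rightarrow> 'q) \<Rightarrow> ('i \<Rightarrow> 'q \<Rightarrow> real) \<Rightarrow>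
   ('i \<Rightarrow> real) \<Rightarrow> ('i \<Rightarrow> real \<Rightarrow> real) \<Rightarrow> real \<Rightarrow> ('q \<Rightarrow> real) \<Rightarrow> bool" where
  "difference_equation I D up down c a F \<theta> V \<longleftrightarrow>
     (\<forall>x\<in>D. \<theta> = (\<Sum>i\<in>I. c i x + a i * (V (up i x) - V x) + F i (V x - V (down i x))))"

text \<open>\<open>top_reachable\<close> expresses that arrivals alone lead from every state to
  \<open>top\<close>; it is phrased through closed sets because it is applied to a set of
  maximisers.\<close>

locale birth_death_system =
  fixes I :: "'i set" and D :: "'q set" and up down :: "'i \<Rightarrow> 'q \<Rightarrow> 'q" and top :: 'q
    and a :: "'i \<Rightarrow> real" and F :: "'i \<Rightarrow> real \<Rightarrow> real"
  assumes finite_I: "finite I" and finite_D: "finite D" and D_nonempty: "D \<noteq> {}"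
    and up_closed: "\<And>i x. i \<in> I \<Longrightarrow> x \<in> D \<Longrightarrow> up i x \<in> D"
    and down_closed: "\<And>i x. i \<in> I \<Longrightarrow> x \<in> D \<Longrightarrow> down i x \<in> D"
    and top_reachable: "\<And>S. S \<subseteq> D \<Longrightarrow> S \<noteq> {} \<Longrightarrow> (\<And>i x. i \<in> I \<Longrightarrow> x \<in> S \<Longrightarrow> up i x \<in> S) \<Longrightarrow> top \<in> S"
    and a_pos: "\<And>i. i \<in> I \<Longrightarrow> 0 < a i"
    and F_antimono: "\<And>i. i \<in> I \<Longrightarrow> antimono (F i)"
begin

lemma maximum_principle:
  assumes V: "difference_equation I D up down c a F \<theta> V"
    and V': "difference_equation I D up down c a F \<theta>' V'"
    and x: "x \<in> D" and max: "\<And>y. y \<in> D \<Longrightarrow> V' y - V y \<le> V' x - V x"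
  shows maximum_principle_theta_le: "\<theta>' \<le> \<theta>"
    and maximum_principle_up: "\<theta>' = \<theta> \<Longrightarrow> i \<in> I \<Longrightarrow> V' (up i x) - V (up i x) = V' x - V x"
proof -
  let ?g = "\<lambda>V i. c i x + a i * (V (up i x) - V x) + F i (V x - V (down i x))"
  have th: "\<theta> = (\<Sum>i\<in>I. ?g V i)" "\<theta>' = (\<Sum>i\<in>I. ?g V' i)"
    using V V' x unfolding difference_equation_def by auto
  have up: "a i * (V' (up i x) - V' x) \<le> a i * (V (up i x) - V x)" if "i \<in> I" for i
    using max[OF up_closed[OF that x]] a_pos[OF that] by (intro mult_left_mono) auto
  have down: "F i (V' x - V' (down i x)) \<le> F i (V x - V (down i x))" if "i \<in> I" for i
    using max[OF down_closed[OF that x]] by (intro antimonoD[OF F_antimono[OF that]]) auto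
  have le: "?g V' i \<le> ?g V i" if "i \<in> I" for i
    using up[OF that] down[OF that] by linarith
  show "\<theta>' \<le> \<theta>"
    unfolding th by (intro sum_mono le)
  assume "\<theta>' = \<theta>" and i: "i \<in> I"
  \<comment> \<open>Termwise inequalities with equal sums are termwise equalities; as the arrival
    part and the departure part are each ordered, both are then equal.\<close>
  then have "?g V' i = ?g V i"
    using sum_mono_inv[of "?g V'" I "?g V" i] th le finite_I by simp
  then have "a i * (V' (up i x) - V' x) = a i * (V (up i x) - V x)"
    using up[OF i] down[OF i] by linarith
  then show "V' (up i x) - V (up i x) = V' x - V x"
    using a_pos[OF i] by auto
qed

lemma theta_le:
  assumes "difference_equation I D up down c a F \<theta> V"
    and "difference_equation I D up down c a F \<theta>' V'"
  shows "\<theta>' \<le> \<theta>"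
proof -
  obtain x where "x \<in> D" "\<And>y. y \<in> D \<Longrightarrow> V' y - V y \<le> V' x - V x"
    using finite_attains_maximum[OF finite_D D_nonempty, of "\<lambda>x. V' x - V x"] by blast
  then show ?thesis
    using maximum_principle_theta_le assms by metis
qed

text \<open>The maximisers of \<open>V' - V\<close> form a nonempty set closed under arrivals, so it
  contains \<open>top\<close>.\<close>

lemma difference_le_top:
  assumes V: "difference_equation I D up down c a F \<theta> V"
    and V': "difference_equation I D up down c a F \<theta> V'"
    and x: "x \<in> D"
  shows "V' x - V x \<le> V' top - V top"
proof -
  let ?S = "{x \<in> D. \<forall>y\<in>D. V' y - V y \<le> V' x - V x}"
  have "?S \<noteq> {}"
    using finite_attains_maximum[OF finite_D D_nonempty, of "\<lambda>x. V' x - V x"] by blast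
  moreover have "up i x \<in> ?S" if "i \<in> I" "x \<in> ?S" for i x
  proof -
    have "V' (up i x) - V (up i x) = V' x - V x"
      using maximum_principle_up[OF V V', of x i] that by auto
    then show ?thesis
      using that up_closed by auto
  qed
  ultimately have "top \<in> ?S"
    by (intro top_reachable) auto
  then show ?thesis
    using x by blast
qed

theorem has_solution_unique:
  assumes V: "difference_equation I D up down c a F \<theta> V"
  shows "difference_equation I D up down c a F \<theta>' V' \<longleftrightarrow>
    \<theta>' = \<theta> \<and> (\<exists>r. \<forall>x\<in>D. V' x = V x + r)" (is "?L \<longleftrightarrow> ?R")
proof
  assume V': ?L
  have th: "\<theta>' = \<theta>"
    using theta_le[OF V V'] theta_le[OF V' V] by simp
  \<comment> \<open>With equal \<open>\<theta>\<close> the roles of \<open>V\<close> and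
    \<open>V'\<close> can be exchanged, so \<open>top\<close> is both a maximal and a minimal point
    of the difference.\<close>
  have "V' x = V x + (V' top - V top)" if "x \<in> D" for x
    using difference_le_top[OF V _ that] difference_le_top[OF _ V that] V' unfolding th
    by (smt (verit))
  then show ?R
    using th by blast
next
  assume ?R
  then obtain r where r: "\<theta>' = \<theta>" "\<And>x. x \<in> D \<Longrightarrow> V' x = V x + r"
    by blast
  show ?L
    using V r(2) up_closed down_closed unfolding difference_equation_def r(1)
    by (auto intro!: sum.cong)
qed

end

section \<open>Existence for a single queue\<close>

text \<open>The value of \<open>V q - V (q - 1)\<close> forced by the equations at \<open>0, \<dots>, q - 1\<close>.\<close>

fun forced_increment :: "(nat \<Rightarrow> real) \<Rightarrow> real \<Rightarrow> (real \<Rightarrow> real) \<Rightarrow> real \<Rightarrow> nat \<Rightarrow> real" where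
  "forced_increment c a F \<theta> 0 = 0"
| "forced_increment c a F \<theta> (Suc q) = (\<theta> - c q - F (forced_increment c a F \<theta> q)) / a"

lemma continuous_on_forced_increment:
  assumes "continuous_on UNIV F"
  shows "continuous_on S (\<lambda>\<theta>. forced_increment c a F \<theta> q)"
proof (induction q)
  case (Suc q)
  show ?case
    by (auto simp: divide_inverse
        intro!: continuous_intros continuous_on_compose2[OF assms Suc.IH])
qed auto

lemma single_queue_solution_exists:
  fixes a :: real and c :: "nat \<Rightarrow> real"
  assumes a: "0 < a" and c: "\<And>q. 0 \<le> c q"
    and cont: "continuous_on UNIV F"
    and nonpos: "\<And>d. F d \<le> 0" and zero: "\<And>d. d \<le> 0 \<Longrightarrow> F d = 0"
  shows "\<exists>\<theta> V. \<forall>q\<in>{0..NQ}.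
    \<theta> = c q + a * (V (min (q + 1) NQ) - V q) + F (V q - V (q - 1))"
proof -
  let ?d = "forced_increment c a F"
  \<comment> \<open>The defect of the equation at \<open>NQ\<close>, where the arrival term vanishes
    because the queue is full.\<close>
  let ?r = "\<lambda>\<theta>. \<theta> - c NQ - F (?d \<theta> NQ)"
  \<comment> \<open>At \<open>\<theta> = 0\<close> all forced increments are nonpositive, so
    \<open>F\<close> vanishes on them and the defect is \<open>- c NQ\<close>. At
    \<open>\<theta> = c NQ\<close> the defect is minus a value of \<open>F\<close>.\<close>
  have "?d 0 q \<le> 0" for q
  proof (induction q)
    case (Suc q)
    then show ?case
      using zero[of "?d 0 q"] a c[of q] by (simp add: divide_nonpos_pos)
  qed simp
  then have "?r 0 \<le> 0"
    using c zero by simp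
  moreover have "0 \<le> ?r (c NQ)"
    using nonpos by simp
  moreover have "continuous_on {0..c NQ} ?r"
    by (intro continuous_intros continuous_on_compose2[OF cont]
        continuous_on_forced_increment cont) auto
  ultimately obtain \<theta> where \<theta>: "?r \<theta> = 0"
    using IVT'[of ?r 0 0 "c NQ"] c by blast
  \<comment> \<open>Summation starts with the increment at 1; the one at 0 is 0 because a departure
    from an empty queue changes nothing.\<close>
  define V where "V q = (\<Sum>i<q. ?d \<theta> (Suc i))" for q
  have down: "V q - V (q - 1) = ?d \<theta> q" for q
    by (cases q) (auto simp: V_def simp del: forced_increment.simps(2))
  have "\<theta> = c q + a * (V (min (q + 1) NQ) - V q) + F (V q - V (q - 1))" if "q \<le> NQ" for q
  proof (cases "q = NQ")
    case True
    then show ?thesis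
      using \<theta> unfolding down by simp
  next
    case False
    then have "min (q + 1) NQ = Suc q"
      using that by simp
    moreover have "V (Suc q) - V q = (\<theta> - c q - F (?d \<theta> q)) / a"
      using down[of "Suc q"] by simp
    ultimately show ?thesis
      using a unfolding down by simp
  qed
  then show ?thesis
    by (intro exI[of _ \<theta>] exI[of _ V]) simp
qed

section \<open>Integrability under the law of the channel state\<close>

lemma integrable_lborel_scaleR:
  fixes f :: "'a::euclidean_space \<Rightarrow> real"
  assumes "integrable lborel f" "c \<noteq> 0"
  shows "integrable lborel (\<lambda>x. f (c *\<^sub>R x))"
proof -
  have [measurable]: "f \<in> borel_measurable borel"
    using borel_measurable_integrable[OF assms(1)] by simp
  have "integrable (density (distr lborel borel (\<lambda>x::'a. 0 + c *\<^sub>R x)) (\<lambda>_. \<bar>c\<bar> ^ DIM('a))) f"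
    using assms(1) lborel_affine[OF assms(2), of "0::'a"] by simp
  then show ?thesis
    using assms(2) by (simp add: integrable_density integrable_distr_eq)
qed

lemma csi_entry_measurable:
  assumes "csi_law M"
  shows "(\<lambda>H. H $ k $ n) \<in> borel_measurable M"
  using assms distributed_measurable unfolding csi_law_def by fastforce

text \<open>The second moment is dominated by a wider Gaussian: with
  \<open>t = (cmod z)\<^sup>2 / 2\<close>, the bound \<open>t \<le> exp t\<close> gives
  \<open>exp (- (2 * t)) * t \<le> exp (- t)\<close>, whose right side is, up to a constant, the
  density at \<open>z / sqrt 2\<close>.\<close>

lemma csi_gain_integrable:
  assumes M: "csi_law M"
  shows "integrable M (\<lambda>H. (cmod (H $ k $ n))\<^sup>2)"
proof -
  let ?f = std_complex_normal_density
  interpret prob_space M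
    using M unfolding csi_law_def by blast
  have D: "distributed M lborel (\<lambda>H. H $ k $ n) (\<lambda>z. ennreal (?f z))"
    using M unfolding csi_law_def by blast
  have nonneg: "0 \<le> ?f z" for z
    unfolding std_complex_normal_density_def by simp
  have "integrable lborel (\<lambda>z. ?f z * 1)"
    by (subst distributed_integrable[OF D]) (auto simp: nonneg)
  then have "integrable lborel (\<lambda>z. ?f ((1 / sqrt 2) *\<^sub>R z))"
    using integrable_lborel_scaleR[of ?f "1 / sqrt 2"] by simp
  then have "integrable lborel (\<lambda>z. 2 * ?f ((1 / sqrt 2) *\<^sub>R z))"
    by simp
  then have "integrable lborel (\<lambda>z. ?f z * (cmod z)\<^sup>2)"
  proof (rule Bochner_Integration.integrable_bound)
    show "(\<lambda>z. ?f z * (cmod z)\<^sup>2) \<in> borel_measurable lborel"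
      unfolding std_complex_normal_density_def by measurable
    have "?f z * (cmod z)\<^sup>2 \<le> 2 * ?f ((1 / sqrt 2) *\<^sub>R z)" for z
    proof -
      let ?t = "(cmod z)\<^sup>2 / 2"
      have "?t \<le> exp ?t"
        using exp_ge_add_one_self[of ?t] by linarith
      then have "exp (- (2 * ?t)) * ?t \<le> exp (- (2 * ?t)) * exp ?t"
        by (rule mult_left_mono) simp
      also have "\<dots> = exp (- ?t)"
        by (simp flip: exp_add)
      finally have "exp (- (2 * ?t)) * ?t / pi \<le> exp (- ?t) / pi"
        by (intro divide_right_mono) auto
      then show ?thesis
        unfolding std_complex_normal_density_def by (simp add: power_divide field_simps)
    qed
    then show "AE z in lborel. norm (?f z * (cmod z)\<^sup>2) \<le> norm (2 * ?f ((1 / sqrt 2) *\<^sub>R z))"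
      using nonneg by (auto simp: abs_mult)
  qed
  then show ?thesis
    by (subst (asm) distributed_integrable[OF D]) (auto simp: nonneg)
qed

text \<open>From \<open>1 + x * y \<le> (1 + x) * (1 + y)\<close>. The bound separates power from
  channel gain: each is integrable, whereas their product may fail to be.\<close>

lemma ln_one_plus_mult_le:
  fixes x y :: real
  assumes "0 \<le> x" "0 \<le> y"
  shows "ln (1 + x * y) \<le> x + y"
proof -
  have "ln (1 + x * y) \<le> ln ((1 + x) * (1 + y))"
    using assms by (subst ln_le_cancel_iff) (auto simp: algebra_simps intro!: add_pos_nonneg)
  also have "\<dots> = ln (1 + x) + ln (1 + y)"
    using assms by (intro ln_mult_pos) auto
  also have "\<dots> \<le> x + y"
    using assms by (intro add_mono ln_add_one_self_le_self)
  finally show ?thesis .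
qed

section \<open>Water-filling\<close>

lemma rate_integrable:
  assumes M: "csi_law M" and s: "csi_only_subcarrier_policy M s"
    and p: "p \<in> user_power_actions M"
  shows "integrable M (\<lambda>H. s H k n * ln (1 + p H n * (cmod (H $ k $ n))\<^sup>2))"
proof -
  have [measurable]: "(\<lambda>H. H $ k $ n) \<in> borel_measurable M" "(\<lambda>H. s H k n) \<in> borel_measurable M"
      "(\<lambda>H. p H n) \<in> borel_measurable M"
    using csi_entry_measurable[OF M] s p
    unfolding csi_only_subcarrier_policy_def user_power_actions_def by auto
  have p0: "0 \<le> p H n" for H
    using p unfolding user_power_actions_def by blast
  have "integrable M (\<lambda>H. p H n + (cmod (H $ k $ n))\<^sup>2)"
    using p csi_gain_integrable[OF M] unfolding user_power_actions_def by simp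
  then show ?thesis
  proof (rule Bochner_Integration.integrable_bound)
    show "(\<lambda>H. s H k n * ln (1 + p H n * (cmod (H $ k $ n))\<^sup>2)) \<in> borel_measurable M"
      by measurable
    have "norm (s H k n * ln (1 + p H n * (cmod (H $ k $ n))\<^sup>2))
        \<le> norm (p H n + (cmod (H $ k $ n))\<^sup>2)" for H
    proof -
      have "s H k n \<in> {0, 1}"
        using s unfolding csi_only_subcarrier_policy_def by blast
      moreover have "0 \<le> ln (1 + p H n * (cmod (H $ k $ n))\<^sup>2)"
        using p0[of H] by (intro ln_ge_zero) auto
      ultimately show ?thesis
        using ln_one_plus_mult_le[of "p H n" "(cmod (H $ k $ n))\<^sup>2"] p0[of H] by auto
    qed
    then show "AE H in M. norm (s H k n * ln (1 + p H n * (cmod (H $ k $ n))\<^sup>2))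
        \<le> norm (p H n + (cmod (H $ k $ n))\<^sup>2)"
      by simp
  qed
qed

lemma mean_service_rate_nonneg:
  assumes "csi_only_subcarrier_policy M s" "p \<in> user_power_actions M" "0 < Nb k"
  shows "0 \<le> mean_service_rate M s Nb k p"
proof -
  have "0 \<le> s H k n" "0 \<le> p H n" for H n
    using assms unfolding csi_only_subcarrier_policy_def user_power_actions_def
    by (auto, metis insertE less_eq_real_def singletonD zero_le_one)
  then show ?thesis
    using assms(3) unfolding mean_service_rate_def
    by (intro divide_nonneg_pos Bochner_Integration.integral_nonneg sum_nonneg mult_nonneg_nonneg ln_ge_zero) auto
qed

text \<open>The case distinction on \<open>h = 0\<close> is needed because \<open>1 / 0 = 0\<close>.\<close>

definition water_level :: "real \<Rightarrow> real \<Rightarrow> real \<Rightarrow> real" where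
  "water_level \<gamma> w h = (if h = 0 then 0 else max 0 (w / \<gamma> - 1 / h))"

lemma water_level_bounds:
  assumes "0 < \<gamma>" "0 < w" "0 \<le> h"
  shows "0 \<le> water_level \<gamma> w h" "water_level \<gamma> w h \<le> w / \<gamma>"
  using assms unfolding water_level_def by auto

text \<open>First-order optimality for a concave reward: the logarithm lies below its tangent at
  \<open>1 + y * h\<close>, and the slope of the tangent is compared with the power price
  \<open>\<gamma>\<close>.\<close>

lemma water_level_optimal:
  fixes x :: real
  assumes "0 < \<gamma>" "0 < w" "0 \<le> h" "0 \<le> x"
  shows "\<gamma> * water_level \<gamma> w h - w * ln (1 + water_level \<gamma> w h * h) \<le> \<gamma> * x - w * ln (1 + x * h)"
proof -
  define y where "y = water_level \<gamma> w h"
  have y: "0 \<le> y"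
    using water_level_bounds assms unfolding y_def by blast
  have pos: "0 < 1 + y * h" "0 < 1 + x * h"
    using y assms by (auto intro!: add_pos_nonneg)
  have "ln (1 + x * h) - ln (1 + y * h) \<le> (1 + x * h - (1 + y * h)) / (1 + y * h)"
    using ln_diff_le[OF pos(2) pos(1)] .
  then have "w * (ln (1 + x * h) - ln (1 + y * h)) \<le> w * ((x - y) * h / (1 + y * h))"
    using assms by (intro mult_left_mono) (auto simp: algebra_simps)
  \<comment> \<open>Where the water level is positive, the slope \<open>w * h / (1 + y * h)\<close>
    equals \<open>\<gamma>\<close>; where it is 0, the slope \<open>w * h\<close> is at most
    \<open>\<gamma>\<close> and \<open>x - y = x\<close> is nonnegative.\<close>
  also have "\<dots> \<le> \<gamma> * (x - y)"
  proof (cases "0 < y")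
    case True
    then have "h \<noteq> 0" "y = w / \<gamma> - 1 / h"
      unfolding y_def water_level_def by (auto simp: max_def split: if_splits)
    then have "1 + y * h = w * h / \<gamma>" "w * h \<noteq> 0"
      using assms by (auto simp: field_simps)
    then have "w * ((x - y) * h / (1 + y * h)) = \<gamma> * (x - y)"
      using assms by simp
    then show ?thesis
      by simp
  next
    case False
    then have y0: "y = 0"
      using y by simp
    have "w * h \<le> \<gamma>"
    proof (cases "h = 0")
      case False
      then have "w / \<gamma> \<le> 1 / h"
        using y0 unfolding y_def water_level_def by (auto simp: max_def split: if_splits)
      then show ?thesis
        using assms False by (simp add: field_simps)
    qed (use assms in simp)
    then have "w * h * x \<le> \<gamma> * x"
      using assms by (intro mult_right_mono)
    then show ?thesis
      unfolding y0 by (simp add: algebra_simps)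
  qed
  finally show ?thesis
    unfolding y_def by (simp add: algebra_simps)
qed

section \<open>Attainment of the minimum of energy cost minus weighted service rate\<close>

definition energy_cost ::
  "('n::finite, 'k::finite) csi measure \<Rightarrow> real \<Rightarrow> (('n, 'k) csi \<Rightarrow> 'n \<Rightarrow> real) \<Rightarrow> real" where
  "energy_cost M \<gamma> p = \<gamma> * (LINT H|M. (\<Sum>n\<in>UNIV. p H n))"

lemma energy_cost_nonneg:
  assumes "p \<in> user_power_actions M" "0 < \<gamma>"
  shows "0 \<le> energy_cost M \<gamma> p"
  using assms unfolding energy_cost_def user_power_actions_def
  by (auto intro!: mult_nonneg_nonneg Bochner_Integration.integral_nonneg sum_nonneg)

text \<open>With everything under one integral, the minimisation can be done separately for each
  \<open>H\<close> and each subcarrier.\<close>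

lemma energy_minus_rate_eq:
  assumes M: "csi_law M" and s: "csi_only_subcarrier_policy M s"
    and p: "p \<in> user_power_actions M"
  shows "energy_cost M \<gamma> p - mean_service_rate M s Nb k p * \<tau> * d
    = (LINT H|M. (\<Sum>n\<in>UNIV. \<gamma> * p H n
        - \<tau> * d / Nb k * (s H k n * ln (1 + p H n * (cmod (H $ k $ n))\<^sup>2))))"
    and "integrable M (\<lambda>H. \<Sum>n\<in>UNIV. \<gamma> * p H n
        - \<tau> * d / Nb k * (s H k n * ln (1 + p H n * (cmod (H $ k $ n))\<^sup>2)))"
proof -
  have [simp]: "integrable M (\<lambda>H. p H n)" for n
    using p unfolding user_power_actions_def by blast
  note [simp] = rate_integrable[OF M s p]
  show "energy_cost M \<gamma> p - mean_service_rate M s Nb k p * \<tau> * d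
    = (LINT H|M. (\<Sum>n\<in>UNIV. \<gamma> * p H n
        - \<tau> * d / Nb k * (s H k n * ln (1 + p H n * (cmod (H $ k $ n))\<^sup>2))))"
    unfolding energy_cost_def mean_service_rate_def
    by (simp add: sum_subtractf mult_ac flip: sum_distrib_left sum_divide_distrib)
  show "integrable M (\<lambda>H. \<Sum>n\<in>UNIV. \<gamma> * p H n
        - \<tau> * d / Nb k * (s H k n * ln (1 + p H n * (cmod (H $ k $ n))\<^sup>2)))"
    by simp
qed

text \<open>If \<open>d \<le> 0\<close>, service brings no gain and zero power is optimal. If
  \<open>d > 0\<close>, water-filling is optimal pointwise, and its bounded powers are
  integrable.\<close>

lemma energy_minus_rate_attains_minimum:
  assumes M: "csi_law M" and s: "csi_only_subcarrier_policy M s"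
    and Nb: "0 < Nb k" and \<gamma>: "0 < \<gamma>" and \<tau>: "0 < \<tau>"
  shows "\<exists>m. is_minimum m ((\<lambda>p. energy_cost M \<gamma> p - mean_service_rate M s Nb k p * \<tau> * d)
    ` user_power_actions M)"
proof (cases "d \<le> 0")
  case True
  have "0 \<le> energy_cost M \<gamma> p - mean_service_rate M s Nb k p * \<tau> * d"
    if "p \<in> user_power_actions M" for p
    using energy_cost_nonneg[OF that \<gamma>] mean_service_rate_nonneg[where Nb = Nb and k = k, OF s that Nb] \<tau> True
    by (smt (verit) mult_nonneg_nonneg mult_nonneg_nonpos)
  moreover have "(\<lambda>_ _. 0) \<in> user_power_actions M"
    unfolding user_power_actions_def by simp
  moreover have "energy_cost M \<gamma> (\<lambda>_ _. 0) - mean_service_rate M s Nb k (\<lambda>_ _. 0) * \<tau> * d = 0"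
    unfolding energy_cost_def mean_service_rate_def by simp
  ultimately have "is_minimum 0 ((\<lambda>p. energy_cost M \<gamma> p - mean_service_rate M s Nb k p * \<tau> * d)
    ` user_power_actions M)"
    unfolding is_minimum_def by (auto intro!: image_eqI[of _ _ "\<lambda>_ _. 0"])
  then show ?thesis ..
next
  case False
  define w where "w = \<tau> * d / Nb k"
  have w: "0 < w"
    using False \<tau> Nb unfolding w_def by simp
  \<comment> \<open>The factor \<open>s H k n\<close> switches power off on subcarriers assigned to
    other users, where it would cost energy without raising the rate.\<close>
  define p0 where "p0 H n = s H k n * water_level \<gamma> w ((cmod (H $ k $ n))\<^sup>2)" for H n
  interpret prob_space M
    using M unfolding csi_law_def by blast
  have s01: "s H k n \<in> {0, 1}" for H n
    using s unfolding csi_only_subcarrier_policy_def by blast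
  note wl = water_level_bounds[OF \<gamma> w zero_le_power2]
  have p0: "p0 \<in> user_power_actions M"
  proof -
    have "0 \<le> p0 H n" "p0 H n \<le> w / \<gamma>" for H n
      using s01[of H n] wl w \<gamma> unfolding p0_def by auto
    moreover have "(\<lambda>H. p0 H n) \<in> borel_measurable M" for n
    proof -
      have [measurable]: "(\<lambda>H. H $ k $ n) \<in> borel_measurable M" "(\<lambda>H. s H k n) \<in> borel_measurable M"
        using csi_entry_measurable[OF M] s unfolding csi_only_subcarrier_policy_def by auto
      show ?thesis
        unfolding p0_def water_level_def by measurable
    qed
    ultimately show ?thesis
      unfolding user_power_actions_def by (auto intro!: integrable_const_bound[where B = "w / \<gamma>"])
  qed
  have "energy_cost M \<gamma> p0 - mean_service_rate M s Nb k p0 * \<tau> * d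
      \<le> energy_cost M \<gamma> p - mean_service_rate M s Nb k p * \<tau> * d"
    if p: "p \<in> user_power_actions M" for p
    unfolding energy_minus_rate_eq(1)[OF M s p0] energy_minus_rate_eq(1)[OF M s p]
  proof (intro integral_mono energy_minus_rate_eq(2) M s p p0 sum_mono)
    fix H n
    have "0 \<le> p H n"
      using p unfolding user_power_actions_def by blast
    then show "\<gamma> * p0 H n - \<tau> * d / Nb k * (s H k n * ln (1 + p0 H n * (cmod (H $ k $ n))\<^sup>2))
      \<le> \<gamma> * p H n - \<tau> * d / Nb k * (s H k n * ln (1 + p H n * (cmod (H $ k $ n))\<^sup>2))"
      using s01[of H n] \<gamma> water_level_optimal[OF \<gamma> w zero_le_power2]
      unfolding p0_def w_def[symmetric] by auto
  qed
  then have "is_minimum (energy_cost M \<gamma> p0 - mean_service_rate M s Nb k p0 * \<tau> * d)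
    ((\<lambda>p. energy_cost M \<gamma> p - mean_service_rate M s Nb k p * \<tau> * d) ` user_power_actions M)"
    using p0 unfolding is_minimum_def by auto
  then show ?thesis ..
qed

section \<open>Reduction of the Bellman equations to difference equations\<close>

text \<open>The definite description is meaningful only where the minimum is attained.\<close>

definition min_energy_cost ::
  "('n::finite, 'k::finite) csi measure \<Rightarrow> (('n, 'k) csi \<Rightarrow> 'k \<Rightarrow> 'n \<Rightarrow> real) \<Rightarrow>
   ('k \<Rightarrow> real) \<Rightarrow> real \<Rightarrow> real \<Rightarrow> 'k \<Rightarrow> real \<Rightarrow> real" where
  "min_energy_cost M s Nb \<gamma> \<tau> k d =
     (THE m. is_minimum m ((\<lambda>p. energy_cost M \<gamma> p - mean_service_rate M s Nb k p * \<tau> * d)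
        ` user_power_actions M))"

lemma finite_queue_states: "finite (queue_states NQ :: ('k::finite \<Rightarrow> nat) set)"
proof -
  have "queue_states NQ = (PiE UNIV (\<lambda>_. {..NQ}) :: ('k \<Rightarrow> nat) set)"
    unfolding queue_states_def by auto
  then show ?thesis
    by (simp add: finite_PiE)
qed

lemma sum_of_bool_eq_mult:
  fixes f :: "'a \<Rightarrow> real"
  assumes "finite D" "x \<in> D"
  shows "(\<Sum>y\<in>D. of_bool (y = x) * f y) = f x"
proof -
  have "(\<Sum>y\<in>D. of_bool (y = x) * f y) = (\<Sum>y\<in>D. if y = x then f y else 0)"
    by (intro sum.cong) auto
  then show ?thesis
    using assms by simp
qed

lemma queue_states_closed:
  assumes "Q \<in> queue_states NQ"
  shows "Q(k := min (Q k + 1) NQ) \<in> queue_states NQ" "Q(k := Q k - 1) \<in> queue_states NQ"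
  using assms unfolding queue_states_def by (auto simp: le_diff_conv intro: le_SucI)

text \<open>The masses add up to 1, so \<open>V Q\<close> splits off and mean increments remain.
  Each indicator is summed on its own, so coinciding states at full or empty queues call for no case
  distinction.\<close>

lemma birth_death_kernel_expectation:
  assumes Q: "Q \<in> queue_states NQ"
  shows "(\<Sum>Q'\<in>queue_states NQ. birth_death_kernel NQ arr \<tau> \<mu> Q Q' * V Q') =
    V Q + (\<Sum>k\<in>UNIV. arr k * \<tau> * (V (Q(k := min (Q k + 1) NQ)) - V Q)
      - \<mu> k * \<tau> * (V Q - V (Q(k := Q k - 1))))"
proof -
  note mem = queue_states_closed[OF Q]
  have point: "(\<Sum>Q'\<in>queue_states NQ. c * of_bool (Q' = X) * V Q') = c * V X"
    if "X \<in> queue_states NQ" for c X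
    using sum_of_bool_eq_mult[OF finite_queue_states that, of V]
    by (simp add: mult.assoc flip: sum_distrib_left)
  have "(\<Sum>Q'\<in>queue_states NQ. birth_death_kernel NQ arr \<tau> \<mu> Q Q' * V Q') =
    (\<Sum>k\<in>UNIV. (\<Sum>Q'\<in>queue_states NQ. arr k * \<tau> * of_bool (Q' = Q(k := min (Q k + 1) NQ)) * V Q')
      + (\<Sum>Q'\<in>queue_states NQ. \<mu> k * \<tau> * of_bool (Q' = Q(k := Q k - 1)) * V Q'))
    + (\<Sum>Q'\<in>queue_states NQ. (1 - (\<Sum>k\<in>UNIV. arr k * \<tau> + \<mu> k * \<tau>)) * of_bool (Q' = Q) * V Q')"
    unfolding birth_death_kernel_def distrib_right sum.distrib sum_distrib_right
    by (subst (1 2) sum.swap) (rule refl)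
  also have "\<dots> = (\<Sum>k\<in>UNIV. arr k * \<tau> * V (Q(k := min (Q k + 1) NQ))
      + \<mu> k * \<tau> * V (Q(k := Q k - 1))) + (1 - (\<Sum>k\<in>UNIV. arr k * \<tau> + \<mu> k * \<tau>)) * V Q"
    by (simp only: point[OF mem(1)] point[OF mem(2)] point[OF Q])
  also have "\<dots> = V Q + (\<Sum>k\<in>UNIV. arr k * \<tau> * (V (Q(k := min (Q k + 1) NQ)) - V Q)
      - \<mu> k * \<tau> * (V Q - V (Q(k := Q k - 1))))"
    by (simp add: algebra_simps sum.distrib sum_subtractf sum_distrib_left)
  finally show ?thesis .
qed

context
  fixes M :: "('n::finite, 'k::finite) csi measure"
    and s :: "('n, 'k) csi \<Rightarrow> 'k \<Rightarrow> 'n \<Rightarrow> real"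
    and Nb \<beta> arr :: "'k \<Rightarrow> real"
    and \<gamma> \<tau> :: real
    and NQ :: nat
  assumes M: "csi_law M"
    and s: "csi_only_subcarrier_policy M s"
    and Nb: "\<And>k. 0 < Nb k"
    and \<beta>: "\<And>k. 0 < \<beta> k"
    and arr: "\<And>k. 0 < arr k"
    and \<gamma>: "0 < \<gamma>"
    and \<tau>: "0 < \<tau>"
begin

abbreviation "F \<equiv> min_energy_cost M s Nb \<gamma> \<tau>"
abbreviation "user_equation k \<equiv> difference_equation {k} {0..NQ}
  (\<lambda>_ q. min (q + 1) NQ) (\<lambda>_ q. q - 1) (\<lambda>k q. \<beta> k * real q / arr k) (\<lambda>k. arr k * \<tau>) F"
abbreviation "joint_equation \<equiv> difference_equation UNIV (queue_states NQ)
  (\<lambda>k Q. Q(k := min (Q k + 1) NQ)) (\<lambda>k Q. Q(k := Q k - 1)) 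
  (\<lambda>k Q. \<beta> k * real (Q k) / arr k) (\<lambda>k. arr k * \<tau>) F"

lemma is_minimum_min_energy_cost:
  "is_minimum (F k d) ((\<lambda>p. energy_cost M \<gamma> p - mean_service_rate M s Nb k p * \<tau> * d)
    ` user_power_actions M)"
  unfolding min_energy_cost_def
  using energy_minus_rate_attains_minimum[of M s Nb k \<gamma> \<tau> d, OF M s Nb \<gamma> \<tau>] is_minimum_unique
  by (metis (no_types, lifting) theI)

lemma min_energy_cost_regular:
  shows min_energy_cost_antimono: "antimono (F k)"
    and min_energy_cost_continuous: "continuous_on UNIV (F k)"
proof -
  have nonneg: "0 \<le> mean_service_rate M s Nb k p * \<tau>" if "p \<in> user_power_actions M" for p
    using mean_service_rate_nonneg[where Nb = Nb and k = k, OF s that Nb] \<tau> by simp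
  note regular = minimum_of_affine[where B = "\<lambda>p. mean_service_rate M s Nb k p * \<tau>",
      OF is_minimum_min_energy_cost nonneg]
  show "antimono (F k)"
    by (rule regular(1))
  show "continuous_on UNIV (F k)"
    by (rule regular(2))
qed

lemma min_energy_cost_nonpos: "F k d \<le> 0"
proof -
  have "(\<lambda>_ _. 0) \<in> user_power_actions M"
    unfolding user_power_actions_def by simp
  moreover have "energy_cost M \<gamma> (\<lambda>_ _. 0) - mean_service_rate M s Nb k (\<lambda>_ _. 0) * \<tau> * d = 0"
    unfolding energy_cost_def mean_service_rate_def by simp
  ultimately show ?thesis
    using is_minimum_min_energy_cost[of k d] unfolding is_minimum_def by force
qed

text \<open>At \<open>d = 0\<close> only the nonnegative energy remains, so
  \<open>0 \<le> F k 0\<close>; monotonicity carries this to all \<open>d \<le> 0\<close>, where it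
  meets the upper bound coming from zero power.\<close>

lemma min_energy_cost_eq_0:
  assumes "d \<le> 0"
  shows "F k d = 0"
proof -
  obtain p where "p \<in> user_power_actions M" "F k 0 = energy_cost M \<gamma> p"
    using is_minimum_min_energy_cost[of k 0] unfolding is_minimum_def by auto
  then have "0 \<le> F k 0"
    using energy_cost_nonneg[OF _ \<gamma>] by simp
  then show ?thesis
    using antimonoD[OF min_energy_cost_antimono assms, of k] min_energy_cost_nonpos[of k d]
    by linarith
qed

text \<open>Neither the queue cost nor the arrival term depends on the action, so both move out of
  the minimum.\<close>

lemma user_bellman_solution_iff:
  "user_bellman_solution M s Nb \<beta> arr \<gamma> \<tau> NQ k \<theta> V \<longleftrightarrow> user_equation k \<theta> V"
proof -
  have "is_minimum \<theta> ((\<lambda>p. user_reward M \<beta> arr \<gamma> k q p + arr k * \<tau> * potential_increment NQ V (q + 1)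
       - mean_service_rate M s Nb k p * \<tau> * potential_increment NQ V q) ` user_power_actions M)
    \<longleftrightarrow> \<theta> = \<beta> k * real q / arr k + arr k * \<tau> * (V (min (q + 1) NQ) - V q) + F k (V q - V (q - 1))"
    if "q \<le> NQ" for q
  proof -
    let ?c = "\<beta> k * real q / arr k + arr k * \<tau> * (V (min (q + 1) NQ) - V q)"
    have fun_eq: "(\<lambda>p. user_reward M \<beta> arr \<gamma> k q p + arr k * \<tau> * potential_increment NQ V (q + 1)
       - mean_service_rate M s Nb k p * \<tau> * potential_increment NQ V q)
      = (\<lambda>p. ?c + (energy_cost M \<gamma> p - mean_service_rate M s Nb k p * \<tau> * (V q - V (q - 1))))"
      using that unfolding user_reward_def potential_increment_def energy_cost_def
      by (auto simp: min_absorb1)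
    show ?thesis
      unfolding fun_eq by (rule is_minimum_unique[OF is_minimum_add_const[OF is_minimum_min_energy_cost]])
  qed
  then show ?thesis
    unfolding user_bellman_solution_def difference_equation_def by auto
qed

lemma reward_eq:
  assumes p: "p \<in> power_actions M"
  shows "reward M \<beta> arr \<gamma> Q p = (\<Sum>k\<in>UNIV. \<beta> k * real (Q k) / arr k + energy_cost M \<gamma> (\<lambda>H. p H k))"
proof -
  interpret prob_space M
    using M unfolding csi_law_def by blast
  have [simp]: "integrable M (\<lambda>H. p H k n)" for k n
    using p unfolding power_actions_def by blast
  show ?thesis
    unfolding reward_def energy_cost_def by (simp add: sum.distrib sum_distrib_left prob_space)
qed

text \<open>The subcarriers are fixed, so the energy and the rate of a user depend on that user's
  powers alone and the minimum splits into a sum over users. The \<open>V Q\<close> from the kernel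
  cancels the one added to \<open>\<theta>\<close>.\<close>

lemma bellman_solution_iff:
  "bellman_solution M s Nb \<beta> arr \<gamma> \<tau> NQ \<theta> V \<longleftrightarrow> joint_equation \<theta> V"
proof -
  have "is_minimum (\<theta> + V Q) ((\<lambda>p. reward M \<beta> arr \<gamma> Q p
       + (\<Sum>Q'\<in>queue_states NQ. birth_death_kernel NQ arr \<tau>
           (\<lambda>k. mean_service_rate M s Nb k (\<lambda>H. p H k)) Q Q' * V Q')) ` power_actions M)
    \<longleftrightarrow> \<theta> = (\<Sum>k\<in>UNIV. \<beta> k * real (Q k) / arr k + arr k * \<tau> * (V (Q(k := min (Q k + 1) NQ)) - V Q)
        + F k (V Q - V (Q(k := Q k - 1))))" (is "is_minimum _ ((\<lambda>p. ?f p) ` _) \<longleftrightarrow> _")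
    if Q: "Q \<in> queue_states NQ" for Q
  proof -
    let ?d = "\<lambda>k. V Q - V (Q(k := Q k - 1))"
    let ?c = "V Q + (\<Sum>k\<in>UNIV. \<beta> k * real (Q k) / arr k + arr k * \<tau> * (V (Q(k := min (Q k + 1) NQ)) - V Q))"
    let ?g = "\<lambda>k u. energy_cost M \<gamma> u - mean_service_rate M s Nb k u * \<tau> * ?d k"
    have "?f p = ?c + (\<Sum>k\<in>UNIV. ?g k (\<lambda>H. p H k))" if "p \<in> power_actions M" for p
      unfolding reward_eq[OF that] birth_death_kernel_expectation[OF Q]
      by (simp add: sum.distrib sum_subtractf)
    then have image: "(\<lambda>p. ?f p) ` power_actions M
        = (\<lambda>p. ?c + (\<Sum>k\<in>UNIV. ?g k (\<lambda>H. p H k))) ` power_actions M"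
      by (rule image_cong[OF refl])
    have "is_minimum (\<Sum>k\<in>UNIV. F k (?d k)) ((\<lambda>p. \<Sum>k\<in>UNIV. ?g k (\<lambda>H. p H k)) ` power_actions M)"
    proof (rule is_minimum_sum[OF is_minimum_min_energy_cost])
      show "(\<lambda>H. p H k) \<in> user_power_actions M" if "p \<in> power_actions M" for p k
        using that unfolding power_actions_def user_power_actions_def by blast
      fix u :: "'k \<Rightarrow> ('n, 'k) csi \<Rightarrow> 'n \<Rightarrow> real"
      assume "\<And>k. u k \<in> user_power_actions M"
      then have "(\<lambda>H k. u k H) \<in> power_actions M"
        unfolding power_actions_def user_power_actions_def by blast
      then show "\<exists>p\<in>power_actions M. \<forall>k. (\<lambda>H. p H k) = u k"
        by (intro bexI[of _ "\<lambda>H k. u k H"]) auto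
    qed
    from is_minimum_unique[OF is_minimum_add_const[OF this, of ?c]] show ?thesis
      unfolding image by (simp only:) (auto simp: sum.distrib)
  qed
  then show ?thesis
    unfolding bellman_solution_def difference_equation_def by auto
qed

section \<open>Reachability of the full state, for one queue and jointly\<close>

lemma birth_death_system_user:
  "birth_death_system {k} {0..NQ} (\<lambda>_ q. min (q + 1) NQ) (\<lambda>_ q. q - 1) NQ (\<lambda>k. arr k * \<tau>) F"
proof unfold_locales
  fix S :: "nat set"
  assume S: "S \<subseteq> {0..NQ}" "S \<noteq> {}" and up: "\<And>i x. i \<in> {k} \<Longrightarrow> x \<in> S \<Longrightarrow> min (x + 1) NQ \<in> S"
  have fin: "finite S"
    using S(1) finite_subset by blast
  \<comment> \<open>The maximum of \<open>S\<close> moved up stays in \<open>S\<close>, so it does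
    not exceed the maximum; this forces the truncation at \<open>NQ\<close> to have taken
    effect.\<close>
  have "min (Max S + 1) NQ \<in> S"
    using up Max_in[OF fin S(2)] by simp
  moreover from this have "min (Max S + 1) NQ \<le> Max S"
    using fin by simp
  ultimately show "NQ \<in> S"
    by (auto simp: min_def split: if_splits)
qed (auto simp: arr \<tau> min_energy_cost_antimono)

lemma birth_death_system_joint:
  "birth_death_system UNIV (queue_states NQ) (\<lambda>k Q. Q(k := min (Q k + 1) NQ))
    (\<lambda>k Q. Q(k := Q k - 1)) (\<lambda>_. NQ) (\<lambda>k. arr k * \<tau>) F"
proof unfold_locales
  fix S :: "('k \<Rightarrow> nat) set"
  assume S: "S \<subseteq> queue_states NQ" "S \<noteq> {}"
    and up: "\<And>k Q. k \<in> UNIV \<Longrightarrow> Q \<in> S \<Longrightarrow> Q(k := min (Q k + 1) NQ) \<in> S"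
  have "finite S"
    using S(1) finite_queue_states finite_subset by blast
  \<comment> \<open>A state of \<open>S\<close> with maximal total queue length: a queue that is not
    full could receive an arrival, which would increase the total.\<close>
  then obtain Q where Q: "Q \<in> S" "\<And>Q'. Q' \<in> S \<Longrightarrow> real (\<Sum>k\<in>UNIV. Q' k) \<le> real (\<Sum>k\<in>UNIV. Q k)"
    using finite_attains_maximum[of S "\<lambda>Q. real (\<Sum>k\<in>UNIV. Q k)"] S(2) by blast
  have "Q k = NQ" for k
  proof (rule ccontr)
    assume "Q k \<noteq> NQ"
    moreover have "Q k \<le> NQ"
      using Q(1) S(1) unfolding queue_states_def by blast
    ultimately have "Q k < (Q(k := min (Q k + 1) NQ)) k"
      by simp
    then have "(\<Sum>j\<in>UNIV. Q j) < (\<Sum>j\<in>UNIV. (Q(k := min (Q k + 1) NQ)) j)"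
      by (intro sum_strict_mono_ex1) auto
    then show False
      using Q(2)[OF up[OF UNIV_I Q(1), of k]] by linarith
  qed
  then have "Q = (\<lambda>_. NQ)"
    by auto
  then show "(\<lambda>_. NQ) \<in> S"
    using Q(1) by simp
next
  show "queue_states NQ \<noteq> ({} :: ('k \<Rightarrow> nat) set)"
    unfolding queue_states_def by (auto intro!: exI[of _ "\<lambda>_. 0"])
qed (assumption | rule queue_states_closed finite_queue_states min_energy_cost_antimono
    | simp add: arr \<tau>)+

section \<open>Solvability and decomposition over the users\<close>

lemma user_equation_solvable: "\<exists>\<theta> V. user_equation k \<theta> V"
  using single_queue_solution_exists[of "arr k * \<tau>" "\<lambda>q. \<beta> k * real q / arr k" "F k" NQ]
    arr[of k] \<beta>[of k] \<tau> min_energy_cost_continuous min_energy_cost_nonpos min_energy_cost_eq_0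
  unfolding difference_equation_def by (simp add: less_imp_le)

text \<open>Changing one queue changes one summand of the potential, so joint increments are
  increments of single users and the users' equations add up.\<close>

lemma joint_equation_sum:
  assumes "\<And>k. user_equation k (\<theta> k) (V k)"
  shows "joint_equation (\<Sum>k\<in>UNIV. \<theta> k) (\<lambda>Q. \<Sum>k\<in>UNIV. V k (Q k))"
proof -
  have diff: "(\<Sum>j\<in>UNIV. V j ((Q(k := q)) j)) - (\<Sum>j\<in>UNIV. V j (Q j)) = V k q - V k (Q k)"
    for Q k q
    by (subst (1 2) sum.remove[of UNIV k]) auto
  have diff': "(\<Sum>j\<in>UNIV. V j (Q j)) - (\<Sum>j\<in>UNIV. V j ((Q(k := q)) j)) = V k (Q k) - V k q"
    for Q k q
    using diff[of Q k q] by linarith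
  show ?thesis
    unfolding difference_equation_def diff diff'
  proof
    fix Q :: "'k \<Rightarrow> nat"
    assume "Q \<in> queue_states NQ"
    then have "Q k \<in> {0..NQ}" for k
      unfolding queue_states_def by simp
    then show "(\<Sum>k\<in>UNIV. \<theta> k) = (\<Sum>k\<in>UNIV. \<beta> k * real (Q k) / arr k
      + arr k * \<tau> * (V k (min (Q k + 1) NQ) - V k (Q k)) + F k (V k (Q k) - V k (Q k - 1)))"
      using assms unfolding difference_equation_def by (intro sum.cong) auto
  qed
qed

text \<open>By uniqueness every joint solution is a shift of one fixed sum of user solutions, and
  the shift can be absorbed into the user potentials. Conversely, sums of user solutions solve the
  joint equation, whatever constants they carry.\<close>

lemma bellman_decomposition:
  "has_solution_unique_up_to_constant (queue_states NQ) (bellman_solution M s Nb \<beta> arr \<gamma> \<tau> NQ)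
   \<and> (\<forall>k. has_solution_unique_up_to_constant {0..NQ}
       (user_bellman_solution M s Nb \<beta> arr \<gamma> \<tau> NQ k))
   \<and> (\<forall>\<theta> V. bellman_solution M s Nb \<beta> arr \<gamma> \<tau> NQ \<theta> V \<longleftrightarrow>
        (\<exists>\<theta>u Vu. (\<forall>k. user_bellman_solution M s Nb \<beta> arr \<gamma> \<tau> NQ k (\<theta>u k) (Vu k))
           \<and> \<theta> = (\<Sum>k\<in>UNIV. \<theta>u k)
           \<and> (\<forall>Q\<in>queue_states NQ. V Q = (\<Sum>k\<in>UNIV. Vu k (Q k)))))"
proof -
  have user_eq: "user_bellman_solution M s Nb \<beta> arr \<gamma> \<tau> NQ k = user_equation k" for k
    by (intro ext) (rule user_bellman_solution_iff)
  have joint_eq: "bellman_solution M s Nb \<beta> arr \<gamma> \<tau> NQ = joint_equation"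
    by (intro ext) (rule bellman_solution_iff)
  note joint = birth_death_system.has_solution_unique[OF birth_death_system_joint]
  note user = birth_death_system.has_solution_unique[OF birth_death_system_user]
  have "\<forall>k. \<exists>p. user_equation k (fst p) (snd p)"
    using user_equation_solvable by simp
  from choice[OF this] obtain p where p: "\<And>k. user_equation k (fst (p k)) (snd (p k))"
    by blast
  define \<theta>0 where "\<theta>0 = (\<lambda>k. fst (p k))"
  define V0 where "V0 = (\<lambda>k. snd (p k))"
  have sol: "user_equation k (\<theta>0 k) (V0 k)" for k
    unfolding \<theta>0_def V0_def by (rule p)
  have joint_sol: "joint_equation (\<Sum>k\<in>UNIV. \<theta>0 k) (\<lambda>Q. \<Sum>k\<in>UNIV. V0 k (Q k))"
    by (rule joint_equation_sum) (rule sol)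
  have joint_unique: "has_solution_unique_up_to_constant (queue_states NQ) joint_equation"
    unfolding has_solution_unique_up_to_constant_def
    by (intro exI allI) (rule joint[OF joint_sol])
  have user_unique: "has_solution_unique_up_to_constant {0..NQ} (user_equation k)" for k
    unfolding has_solution_unique_up_to_constant_def by (intro exI allI) (rule user[OF sol])
  have split: "\<exists>\<theta>u Vu. (\<forall>k. user_equation k (\<theta>u k) (Vu k)) \<and> \<theta> = (\<Sum>k\<in>UNIV. \<theta>u k)
      \<and> (\<forall>Q\<in>queue_states NQ. V Q = (\<Sum>k\<in>UNIV. Vu k (Q k)))" if V: "joint_equation \<theta> V" for \<theta> V
  proof -
    obtain r where th: "\<theta> = (\<Sum>k\<in>UNIV. \<theta>0 k)"
      and r: "\<And>Q. Q \<in> queue_states NQ \<Longrightarrow> V Q = (\<Sum>k\<in>UNIV. V0 k (Q k)) + r"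
      using joint[OF joint_sol, THEN iffD1, OF V] by blast
    \<comment> \<open>The additive constant is shared equally among the users.\<close>
    define Vu where "Vu k q = V0 k q + r / real CARD('k)" for k q
    have "user_equation k (\<theta>0 k) (Vu k)" for k
      by (rule user[OF sol, THEN iffD2]) (auto simp: Vu_def)
    moreover have "V Q = (\<Sum>k\<in>UNIV. Vu k (Q k))" if "Q \<in> queue_states NQ" for Q
      using r[OF that] unfolding Vu_def by (simp add: sum.distrib)
    ultimately show ?thesis
      using th by blast
  qed
  \<comment> \<open>\<open>V\<close> is known to agree with the sum of the user potentials on
    \<open>queue_states NQ\<close> only, so the solution property is transferred by the uniqueness
    theorem with additive constant 0.\<close>
  have combine: "joint_equation \<theta> V"
    if u: "\<And>k. user_equation k (\<theta>u k) (Vu k)" and "\<theta> = (\<Sum>k\<in>UNIV. \<theta>u k)"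
      and "\<And>Q. Q \<in> queue_states NQ \<Longrightarrow> V Q = (\<Sum>k\<in>UNIV. Vu k (Q k))" for \<theta> V \<theta>u Vu
    by (rule joint[OF joint_equation_sum[OF u], THEN iffD2]) (use that(2,3) in auto)
  have "joint_equation \<theta> V \<longleftrightarrow> (\<exists>\<theta>u Vu. (\<forall>k. user_equation k (\<theta>u k) (Vu k))
      \<and> \<theta> = (\<Sum>k\<in>UNIV. \<theta>u k) \<and> (\<forall>Q\<in>queue_states NQ. V Q = (\<Sum>k\<in>UNIV. Vu k (Q k))))" for \<theta> V
  proof
    assume "\<exists>\<theta>u Vu. (\<forall>k. user_equation k (\<theta>u k) (Vu k))
      \<and> \<theta> = (\<Sum>k\<in>UNIV. \<theta>u k) \<and> (\<forall>Q\<in>queue_states NQ. V Q = (\<Sum>k\<in>UNIV. Vu k (Q k)))"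
    then obtain \<theta>u Vu where u: "\<forall>k. user_equation k (\<theta>u k) (Vu k)" "\<theta> = (\<Sum>k\<in>UNIV. \<theta>u k)"
        "\<forall>Q\<in>queue_states NQ. V Q = (\<Sum>k\<in>UNIV. Vu k (Q k))"
      by (elim exE conjE)
    show "joint_equation \<theta> V"
      by (rule combine[OF spec[OF u(1)] u(2) bspec[OF u(3)]])
  qed (rule split)
  then show ?thesis
    unfolding user_eq joint_eq by (intro conjI allI joint_unique user_unique)
qed

end

theorem theorem2:
  fixes M :: "('n::finite, 'k::finite) csi measure"
    and s :: "('n, 'k) csi \<Rightarrow> 'k \<Rightarrow> 'n \<Rightarrow> real"
    and Nb \<beta> arr :: "'k \<Rightarrow> real"
    and \<gamma> \<tau> :: real
    and NQ :: nat
  assumes "csi_law M"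
    and "csi_only_subcarrier_policy M s"
    and "\<And>k. 0 < Nb k"
    and "\<And>k. 0 < \<beta> k"
    and "\<And>k. 0 < arr k"
    and "0 < \<gamma>"
    and "0 < \<tau>"
  shows "has_solution_unique_up_to_constant (queue_states NQ)
           (bellman_solution M s Nb \<beta> arr \<gamma> \<tau> NQ)
       \<and> (\<forall>k. has_solution_unique_up_to_constant {0..NQ}
           (user_bellman_solution M s Nb \<beta> arr \<gamma> \<tau> NQ k))
       \<and> (\<forall>\<theta> V. bellman_solution M s Nb \<beta> arr \<gamma> \<tau> NQ \<theta> V \<longleftrightarrow>
            (\<exists>\<theta>u Vu. (\<forall>k. user_bellman_solution M s Nb \<beta> arr \<gamma> \<tau> NQ k (\<theta>u k) (Vu k))
               \<and> \<theta> = (\<Sum>k\<in>UNIV. \<theta>u k)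
               \<and> (\<forall>Q\<in>queue_states NQ. V Q = (\<Sum>k\<in>UNIV. Vu k (Q k)))))"
  using bellman_decomposition[OF assms] .

end
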